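(* Let $m,n\geq 2$ be integers with $m\not\equiv n \pmod 2$. Then $3\leq\chi_{la}(K_{1,m,n})\leq 4$.
   Context: All graphs are simple and finite. Let $G=(V,E)$ be a graph without isolated vertices. For a bijection $f:E\to\{1,2,\dots,|E|\}$ and a vertex $u$, the weight of $u$ is $w(u)=\sum_{e\in E(u)}f(e)$, where $E(u)$ is the set of edges incident to $u$. The bijection $f$ is a local antimagic labeling of $G$ if $w(u)\neq w(v)$ for every edge $uv\in E$; it then induces a proper vertex coloring of $G$ in which $v$ gets color $w(v)$. The local antimagic chromatic number $\chi_{la}(G)$ is the minimum number of distinct colors (distinct values of $w$) over all local antimagic labelings of $G$. $K_{1,m,n}$ is the complete tripartite graph with parts of sizes $1$, $m$ and $n$. *)

theory Defs
  imports Main "HOL-Library.Extended_Nat"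
begin

text \<open>An undirected graph is a pair of its vertex set and its edge set, an edge being the set of
  its two endpoints.\<close>

type_synonym 'a graph = "'a set \<times> 'a set set"

abbreviation verts :: "'a graph \<Rightarrow> 'a set" where
  "verts G \<equiv> fst G"

abbreviation edges :: "'a graph \<Rightarrow> 'a set set" where
  "edges G \<equiv> snd G"

definition finite_simple_graph :: "'a graph \<Rightarrow> bool" where
  "finite_simple_graph G \<longleftrightarrow> finite (verts G) \<and> (\<forall>e\<in>edges G. e \<subseteq> verts G \<and> card e = 2)"

definition incident_edges :: "'a graph \<Rightarrow> 'a \<Rightarrow> 'a set set" where
  "incident_edges G u = {e \<in> edges G. u \<in> e}"

definition no_isolated_vertices :: "'a graph \<Rightarrow> bool" where
  "no_isolated_vertices G \<longleftrightarrow> (\<forall>u\<in>verts G. incident_edges G u \<noteq> {})"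

definition weight :: "'a graph \<Rightarrow> ('a set \<Rightarrow> nat) \<Rightarrow> 'a \<Rightarrow> nat" where
  "weight G f u = (\<Sum>e\<in>incident_edges G u. f e)"

text \<open>A labeling is a total function of which only the values on the edges matter.\<close>

definition local_antimagic_labeling :: "'a graph \<Rightarrow> ('a set \<Rightarrow> nat) \<Rightarrow> bool" where
  "local_antimagic_labeling G f \<longleftrightarrow>
     bij_betw f (edges G) {1..card (edges G)} \<and>
     (\<forall>u v. {u, v} \<in> edges G \<longrightarrow> weight G f u \<noteq> weight G f v)"

text \<open>The values are extended naturals, so that a graph without any local antimagic labeling
  (such as a single edge) gets the value \<open>\<infinity>\<close>. Otherwise the infimum is attained, i.e. is a minimum.\<close>

definition local_antimagic_chromatic_number :: "'a graph \<Rightarrow> enat" (\<open>\<chi>\<^sub>l\<^sub>a\<close>) where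
  "\<chi>\<^sub>l\<^sub>a G = (INF f \<in> {f. local_antimagic_labeling G f}. enat (card (weight G f ` verts G)))"

text \<open>The vertex \<open>(i, j)\<close> is the \<open>j\<close>-th vertex of the \<open>i\<close>-th part, which has size \<open>ns ! i\<close>.\<close>

definition complete_multipartite :: "nat list \<Rightarrow> (nat \<times> nat) graph" where
  "complete_multipartite ns =
     (let V = (SIGMA i:{..<length ns}. {..<ns ! i})
      in (V, {{u, v} | u v. u \<in> V \<and> v \<in> V \<and> fst u \<noteq> fst v}))"

abbreviation complete_tripartite :: "nat \<Rightarrow> nat \<Rightarrow> nat \<Rightarrow> (nat \<times> nat) graph" where
  "complete_tripartite a b c \<equiv> complete_multipartite [a, b, c]"

lemma finite_simple_graph_complete_multipartite:
  "finite_simple_graph (complete_multipartite ns)"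
  unfolding finite_simple_graph_def complete_multipartite_def Let_def
  by (auto simp: card_2_iff)

lemma no_isolated_vertices_complete_tripartite:
  assumes "a > 0" "b > 0" "c > 0"
  shows "no_isolated_vertices (complete_tripartite a b c)"
  unfolding no_isolated_vertices_def
proof
  fix u assume u: "u \<in> verts (complete_tripartite a b c)"
  define v :: "nat \<times> nat" where "v = (if fst u = 0 then 1 else 0, 0)"
  have "v \<in> verts (complete_tripartite a b c)" "fst u \<noteq> fst v"
    using assms by (auto simp: v_def complete_multipartite_def)
  with u have "{u, v} \<in> edges (complete_tripartite a b c)"
    unfolding complete_multipartite_def Let_def fst_conv snd_conv by blast
  then have "{u, v} \<in> incident_edges (complete_tripartite a b c) u"
    by (simp add: incident_edges_def)
  then show "incident_edges (complete_tripartite a b c) u \<noteq> {}" by blast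
qed

end

theory Submission
  imports Defs "HOL-Combinatorics.Transposition"
begin

text \<open>The edges of \<open>K\<^bsub>1,m,n\<^esub>\<close> are the cells of an \<open>(m + 1) \<times> (n + 1)\<close> array without its corner,
  the row and column of the corner standing for the apex. With \<open>0\<close> in the corner, labelings are
  fillings by \<open>0, \<dots>, N - 1\<close>, where \<open>N = (m + 1) * (n + 1)\<close>; the weights are the sums of the other
  rows and columns, and the apex gets the sum of the corner's row plus that of its column.
  One side of the array is even and the other odd. If the even side counts the rows, pairing the rows
  into complements \<open>x \<leftrightarrow> N - 1 - x\<close> makes all column sums equal to some \<open>C\<close>. Row sums then
  depend on how the odd numbers \<open>\<bar>2 * x - (N - 1)\<bar>\<close> are signed and distributed over the pairs, and this can
  be done so that every signed sum is \<open>1\<close> or \<open>-1\<close>. Hence the row sums take two adjacent values \<open>R\<close> and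
  \<open>R + 1\<close>, and with the apex there are at most four colors. The lower bound comes from a triangle.\<close>

section \<open>Signed odd numbers with row sums 1 or -1\<close>

lemma bij_betw_gridI:
  fixes K :: "nat \<Rightarrow> nat \<Rightarrow> nat"
  assumes "\<And>i c j e. i < a \<Longrightarrow> c < b \<Longrightarrow> j < a \<Longrightarrow> e < b \<Longrightarrow> K i c = K j e \<Longrightarrow> i = j \<and> c = e"
    and "\<And>i c. i < a \<Longrightarrow> c < b \<Longrightarrow> K i c < a * b"
  shows "bij_betw (\<lambda>(i, c). K i c) ({..<a} \<times> {..<b}) {..<a * b}"
proof -
  have inj: "inj_on (\<lambda>(i, c). K i c) ({..<a} \<times> {..<b})"
    using assms(1) by (auto simp: inj_on_def)
  have "(\<lambda>(i, c). K i c) ` ({..<a} \<times> {..<b}) = {..<a * b}"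
    by (rule card_subset_eq) (use assms(2) in \<open>auto simp: card_image[OF inj]\<close>)
  with inj show ?thesis by (simp add: bij_betw_def)
qed

text \<open>Row \<open>i\<close> records one pair of complementary rows. With N = 2 * h * q, the odd
  number \<open>2 * K i c + 1\<close> is the distance |2 * x - (N - 1)| of an entry and of its
  complement, and \<open>S\<close> is the sign given to the first row of the pair.\<close>

definition balanced_signed_array :: "nat \<Rightarrow> nat \<Rightarrow> (nat \<Rightarrow> nat \<Rightarrow> nat) \<Rightarrow> (nat \<Rightarrow> nat \<Rightarrow> int) \<Rightarrow> bool" where
  "balanced_signed_array h q K S \<longleftrightarrow>
     bij_betw (\<lambda>(i, c). K i c) ({..<h} \<times> {..<q}) {..<h * q} \<and>
     (\<forall>i<h. \<forall>c<q. \<bar>S i c\<bar> = 1) \<and>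
     (\<forall>i<h. \<bar>\<Sum>c<q. S i c * (2 * int (K i c) + 1)\<bar> = 1)"

text \<open>In row \<open>i\<close> the entries \<open>b i\<close> and \<open>d i\<close> lie symmetrically about a center, one for the even rows and
  one for the odd rows. So their differences are \<open>1, 3, 5, \<dots>\<close> in both cases, and \<open>d i - b i\<close> is
  \<open>i + 1\<close> for even \<open>i\<close> and \<open>i\<close> for odd \<open>i\<close>.\<close>

lemma balanced_signed_array_3: "\<exists>K S. balanced_signed_array h 3 K S"
proof -
  \<comment> \<open>\<open>k\<close> is the number of even rows. Column 0 takes the values below
    \<open>h\<close>, the even rows pair up those from \<open>h\<close> to
    \<open>h + 2 * k - 1\<close>, and the odd rows the rest up to \<open>3 * h - 1\<close>.\<close>
  define k where "k = (h + 1) div 2"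
  have k: "h \<le> 2 * k" "2 * k \<le> h + 1" by (auto simp: k_def)
  define b where "b i = (if even i then h else 2 * h) + k - 1 - i div 2" for i
  define d where "d i = (if even i then h else 2 * h) + k + i div 2" for i
  define K where "K i c = (if c = 0 then i else if c = 1 then b i else d i)" for i c :: nat
  \<comment> \<open>The signs +, +, - give the row sum 2 * (i - (d i - b i)) + 1, which is -1 in
    even rows and 1 in odd rows.\<close>
  define S :: "nat \<Rightarrow> nat \<Rightarrow> int" where "S i c = (if c = 2 then - 1 else 1)" for i c
  have b_range: "h \<le> b i \<and> b i < 3 * h" and d_range: "h \<le> d i \<and> d i < 3 * h"
    and db: "d i = b i + 2 * (i div 2) + 1" if "i < h" for i
    using that k unfolding b_def d_def by (cases "even i"; auto elim!: evenE oddE)+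
  have b_inj: "b i = b j \<Longrightarrow> i = j" and d_inj: "d i = d j \<Longrightarrow> i = j" and bd: "b i \<noteq> d j"
    if "i < h" "j < h" for i j
    using that k unfolding b_def d_def
    by (cases "even i"; cases "even j"; auto elim!: evenE oddE)+
  have "bij_betw (\<lambda>(i, c). K i c) ({..<h} \<times> {..<3}) {..<h * 3}"
  proof (rule bij_betw_gridI)
    fix i c j e assume *: "i < h" "c < 3" "j < h" "e < (3::nat)" "K i c = K j e"
    then have "c = 0 \<or> c = 1 \<or> c = 2" "e = 0 \<or> e = 1 \<or> e = 2" by auto
    with *(5) show "i = j \<and> c = e"
      using b_range[OF *(1)] d_range[OF *(1)] b_range[OF *(3)] d_range[OF *(3)] *(1,3)
        b_inj[OF *(1,3)] d_inj[OF *(1,3)] bd[OF *(1,3)] bd[OF *(3,1)]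
      unfolding K_def by (elim disjE) simp_all
  next
    fix i c assume "i < h" "c < (3::nat)"
    then show "K i c < h * 3"
      using b_range[of i] d_range[of i] by (simp add: K_def)
  qed
  moreover have "\<forall>i<h. \<forall>c<3. \<bar>S i c\<bar> = 1"
    by (simp add: S_def)
  moreover have "\<bar>\<Sum>c<3. S i c * (2 * int (K i c) + 1)\<bar> = 1" if "i < h" for i
  proof -
    have "(\<Sum>c<3. S i c * (2 * int (K i c) + 1)) = 2 * int i + 2 * int (b i) - 2 * int (d i) + 1"
      by (simp add: numeral_3_eq_3 K_def S_def)
    also have "\<dots> = 2 * (int i - 2 * (int i div 2)) - 1"
      using db[OF that] by simp
    also have "\<bar>\<dots>\<bar> = 1"
      by (cases "even (int i)") (auto elim!: evenE oddE)
    finally show ?thesis .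
  qed
  ultimately have "balanced_signed_array h 3 K S"
    unfolding balanced_signed_array_def by blast
  then show ?thesis by blast
qed

text \<open>Two consecutive odd numbers with opposite signs contribute \<open>2\<close> or \<open>-2\<close>, so they can be chosen
  to flip a row sum between \<open>1\<close> and \<open>-1\<close>.\<close>

lemma balanced_signed_array_add2:
  assumes "balanced_signed_array h q K S"
  shows "\<exists>K' S'. balanced_signed_array h (q + 2) K' S'"
proof -
  define s where "s i = (\<Sum>c<q. S i c * (2 * int (K i c) + 1))" for i
  define K' where "K' i c = (if c < q then K i c else if c = q then h * q + 2 * i
    else h * q + 2 * i + 1)" for i c
  define S' where "S' i c = (if c < q then S i c else if c = q then s i else - s i)" for i c
  have bij: "bij_betw (\<lambda>(i, c). K i c) ({..<h} \<times> {..<q}) {..<h * q}"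
    and S: "\<And>i c. i < h \<Longrightarrow> c < q \<Longrightarrow> \<bar>S i c\<bar> = 1" and s: "\<And>i. i < h \<Longrightarrow> \<bar>s i\<bar> = 1"
    using assms unfolding balanced_signed_array_def s_def by auto
  have K_inj: "i = j \<and> c = e"
    if "i < h" "j < h" "c < q" "e < q" "K i c = K j e" for i j c e
    using bij that by (auto simp: bij_betw_def inj_on_def)
  have K_less: "K i c < h * q" if "i < h" "c < q" for i c
    using bij that by (auto simp: bij_betw_def)
  have "bij_betw (\<lambda>(i, c). K' i c) ({..<h} \<times> {..<q + 2}) {..<h * (q + 2)}"
  proof (rule bij_betw_gridI)
    fix i c j e assume *: "i < h" "c < q + 2" "j < h" "e < q + 2" "K' i c = K' j e"
    have new: "h * q + 2 * a \<noteq> h * q + 2 * b + 1" for a b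
      by presburger
    have "c < q \<or> c = q \<or> c = q + 1" "e < q \<or> e = q \<or> e = q + 1"
      using * by auto
    with *(5) show "i = j \<and> c = e"
      using K_inj[of i j c e] K_less[of i c] K_less[of j e] *(1,3) new new[symmetric]
      unfolding K'_def by (elim disjE) simp_all
  next
    fix i c assume "i < h" "c < q + 2"
    then show "K' i c < h * (q + 2)"
      using K_less[of i c] unfolding K'_def by (cases "c < q") (auto simp: algebra_simps)
  qed
  moreover have "\<forall>i<h. \<forall>c<q + 2. \<bar>S' i c\<bar> = 1"
    using S s by (simp add: S'_def)
  moreover have "\<bar>\<Sum>c<q + 2. S' i c * (2 * int (K' i c) + 1)\<bar> = 1" if "i < h" for i
  proof -
    have "(\<Sum>c<q + 2. S' i c * (2 * int (K' i c) + 1)) =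
      (\<Sum>c<q. S' i c * (2 * int (K' i c) + 1)) - 2 * s i"
      by (simp add: K'_def S'_def algebra_simps)
    also have "(\<Sum>c<q. S' i c * (2 * int (K' i c) + 1)) = s i"
      unfolding s_def by (rule sum.cong) (auto simp: K'_def S'_def)
    finally show ?thesis using s[OF that] by simp
  qed
  ultimately have "balanced_signed_array h (q + 2) K' S'"
    unfolding balanced_signed_array_def by blast
  then show ?thesis by blast
qed

text \<open>Steps of two columns reach every odd width from 3. Width 1 would fail for
  \<open>h > 1\<close>, where some row sum is 3 or -3.\<close>

lemma balanced_signed_array_exists:
  assumes "odd q" "q \<ge> 3"
  shows "\<exists>K S. balanced_signed_array h q K S"
proof -
  have "\<exists>K S. balanced_signed_array h (3 + 2 * k) K S" for k
  proof (induction k)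
    case 0
    show ?case using balanced_signed_array_3 by simp
  next
    case (Suc k)
    then show ?case
      using balanced_signed_array_add2[of h "3 + 2 * k"] by (auto simp: algebra_simps)
  qed
  moreover have "q = 3 + 2 * ((q - 3) div 2)"
    using assms by presburger
  ultimately show ?thesis by metis
qed

section \<open>Arrays with constant column sums and two adjacent row sums\<close>

lemma sum_alternating_pairs: "(\<Sum>r<2 * h. (- 1) ^ r * g (r div 2)) = (0::int)"
  by (induction h) simp_all

text \<open>For positive even \<open>p\<close> and odd \<open>q\<close> the row sums cannot all
  agree, as their average q * (p * q - 1) / 2 is not an integer; two adjacent values come
  closest.\<close>

definition near_magic :: "nat \<Rightarrow> nat \<Rightarrow> (nat \<Rightarrow> nat \<Rightarrow> nat) \<Rightarrow> nat \<Rightarrow> nat \<Rightarrow> bool" where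
  "near_magic p q M C R \<longleftrightarrow>
     bij_betw (\<lambda>(r, c). M r c) ({..<p} \<times> {..<q}) {..<p * q} \<and>
     (\<forall>c<q. (\<Sum>r<p. M r c) = C) \<and>
     (\<forall>r<p. (\<Sum>c<q. M r c) \<in> {R, R + 1})"

text \<open>Each of the \<open>h\<close> complementary pairs contributes
  \<open>2 * h * q - 1\<close> to every column, whence \<open>C\<close>. Twice a row sum is
  \<open>q * (2 * h * q - 1)\<close> plus a signed sum 1 or -1, whence \<open>R\<close>.\<close>

lemma near_magic_exists:
  assumes "h > 0" "odd q" "q \<ge> 3"
  shows "\<exists>M C R. near_magic (2 * h) q M C R \<and> C = h * (2 * h * q - 1) \<and>
    2 * R + 1 = q * (2 * h * q - 1)"
proof -
  obtain K S where "balanced_signed_array h q K S"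
    using balanced_signed_array_exists assms by blast
  then have bij: "bij_betw (\<lambda>(i, c). K i c) ({..<h} \<times> {..<q}) {..<h * q}"
    and S: "\<And>i c. i < h \<Longrightarrow> c < q \<Longrightarrow> \<bar>S i c\<bar> = 1"
    and s: "\<And>i. i < h \<Longrightarrow> \<bar>\<Sum>c<q. S i c * (2 * int (K i c) + 1)\<bar> = 1"
    unfolding balanced_signed_array_def by auto
  have K_inj: "i = j \<and> c = e"
    if "i < h" "j < h" "c < q" "e < q" "K i c = K j e" for i j c e
    using bij that by (auto simp: bij_betw_def inj_on_def)
  have K_less: "K i c < h * q" if "i < h" "c < q" for i c
    using bij that by (auto simp: bij_betw_def)
  define N where "N = 2 * h * q"
  have "N > 0" using assms by (simp add: N_def)
  \<comment> \<open>Rows \<open>2 * i\<close> and \<open>2 * i + 1\<close> come from row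
    \<open>i\<close> of \<open>K\<close>. The condition says that
    \<open>(- 1) ^ r * S (r div 2) c\<close> is 1; then the entry lies \<open>K\<close> steps into
    the upper half of the range, otherwise at the mirror image in the lower half.\<close>
  define M where "M r c = (if (S (r div 2) c = 1) = even r then h * q + K (r div 2) c
    else h * q - 1 - K (r div 2) c)" for r c
  have M: "2 * int (M r c) = int (N - 1) + (- 1) ^ r * (S (r div 2) c * (2 * int (K (r div 2) c) + 1))"
    if "r < 2 * h" "c < q" for r c
  proof -
    have "r div 2 < h" using that by auto
    then have "\<bar>S (r div 2) c\<bar> = 1" "K (r div 2) c < h * q"
      using that S K_less by auto
    then show ?thesis using \<open>N > 0\<close>
      by (cases "even r"; cases "S (r div 2) c = 1")
        (auto simp: M_def N_def of_nat_diff algebra_simps abs_if split: if_splits)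
  qed
  have "bij_betw (\<lambda>(r, c). M r c) ({..<2 * h} \<times> {..<q}) {..<2 * h * q}"
  proof (rule bij_betw_gridI)
    fix r c t e assume "r < 2 * h" "c < q" "t < 2 * h" "e < q" and eq: "M r c = M t e"
    then have *: "r div 2 < h" "t div 2 < h" "c < q" "e < q" by auto
    \<comment> \<open>The half containing an entry decides the sign condition, and the depth inside
      that half is \<open>K\<close>. So \<open>K\<close> determines \<open>r div 2\<close> and
      \<open>c\<close>, and then the sign condition determines the parity of
      \<open>r\<close>.\<close>
    have "K (r div 2) c = K (t div 2) e \<and>
        ((S (r div 2) c = 1) = even r) = ((S (t div 2) e = 1) = even t)"
      using eq K_less[OF *(1,3)] K_less[OF *(2,4)] unfolding M_def by (auto split: if_splits)
    with K_inj[OF *] show "r = t \<and> c = e"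
      by (metis dvd_div_mult_self odd_two_times_div_two_succ)
  next
    fix r c assume "r < 2 * h" "c < q"
    then have "K (r div 2) c < h * q" by (intro K_less) auto
    then show "M r c < 2 * h * q"
      unfolding M_def by (auto simp: mult.assoc)
  qed
  moreover have "(\<Sum>r<2 * h. M r c) = h * (N - 1)" if "c < q" for c
  proof -
    have "2 * int (\<Sum>r<2 * h. M r c) = (\<Sum>r<2 * h. 2 * int (M r c))"
      by (simp add: sum_distrib_left)
    also have "\<dots> = (\<Sum>r<2 * h. int (N - 1) +
        (- 1) ^ r * (S (r div 2) c * (2 * int (K (r div 2) c) + 1)))"
      using that by (intro sum.cong) (auto simp: M)
    also have "\<dots> = 2 * int (h * (N - 1))"
      using sum_alternating_pairs[of "\<lambda>i. S i c * (2 * int (K i c) + 1)" h]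
      by (simp add: sum.distrib)
    finally show ?thesis by linarith
  qed
  moreover have "odd (q * (N - 1))"
    using assms by (auto simp: N_def)
  then obtain R where R: "q * (N - 1) = 2 * R + 1"
    by (elim oddE)
  moreover have "(\<Sum>c<q. M r c) \<in> {R, R + 1}" if "r < 2 * h" for r
  proof -
    let ?t = "\<Sum>c<q. S (r div 2) c * (2 * int (K (r div 2) c) + 1)"
    have "2 * int (\<Sum>c<q. M r c) = (\<Sum>c<q. 2 * int (M r c))"
      by (simp add: sum_distrib_left)
    also have "\<dots> = (\<Sum>c<q. int (N - 1) +
        (- 1) ^ r * (S (r div 2) c * (2 * int (K (r div 2) c) + 1)))"
      using that by (intro sum.cong) (auto simp: M)
    also have "\<dots> = int (q * (N - 1)) + (- 1) ^ r * ?t"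
      by (simp add: sum.distrib sum_distrib_left)
    finally have "2 * int (\<Sum>c<q. M r c) = 2 * int R + 1 + (- 1) ^ r * ?t"
      unfolding R by simp
    moreover have "\<bar>?t\<bar> = 1"
      using that by (intro s) auto
    then have "(- 1) ^ r * ?t = 1 \<or> (- 1) ^ r * ?t = - 1"
      by (cases "even r") auto
    ultimately show ?thesis by (auto simp del: of_nat_sum)
  qed
  ultimately have "near_magic (2 * h) q M (h * (N - 1)) R"
    unfolding near_magic_def by blast
  with R show ?thesis unfolding N_def by metis
qed

text \<open>Permuting rows and columns only permutes the row and column sums, so the cell containing
  0 can be moved to the corner, the one cell without an edge.\<close>

lemma near_magic_corner:
  assumes "near_magic p q M C R" "p > 0" "q > 0"
  shows "\<exists>M'. near_magic p q M' C R \<and> M' 0 0 = 0"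
proof -
  have bij: "bij_betw (\<lambda>(r, c). M r c) ({..<p} \<times> {..<q}) {..<p * q}"
    using assms unfolding near_magic_def by blast
  have "0 \<in> {..<p * q}" using assms by simp
  then have "0 \<in> (\<lambda>(r, c). M r c) ` ({..<p} \<times> {..<q})"
    by (simp only: bij_betw_imp_surj_on[OF bij])
  then obtain r0 c0 where 0: "r0 < p" "c0 < q" "M r0 c0 = 0"
    by auto
  define \<rho> where "\<rho> = transpose 0 r0"
  define \<gamma> where "\<gamma> = transpose 0 c0"
  have \<rho>: "bij_betw \<rho> {..<p} {..<p}" and \<gamma>: "bij_betw \<gamma> {..<q} {..<q}"
    unfolding \<rho>_def \<gamma>_def using 0 assms by simp_all
  define M' where "M' r c = M (\<rho> r) (\<gamma> c)" for r c
  have "bij_betw ((\<lambda>(r, c). M r c) \<circ> map_prod \<rho> \<gamma>) ({..<p} \<times> {..<q}) {..<p * q}"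
    using bij_betw_map_prod[OF \<rho> \<gamma>] bij by (rule bij_betw_trans)
  also have "(\<lambda>(r, c). M r c) \<circ> map_prod \<rho> \<gamma> = (\<lambda>(r, c). M' r c)"
    by (auto simp: M'_def)
  finally have "bij_betw (\<lambda>(r, c). M' r c) ({..<p} \<times> {..<q}) {..<p * q}" .
  moreover have "(\<Sum>r<p. M' r c) = C" if "c < q" for c
    using assms(1) sum.reindex_bij_betw[OF \<rho>, of "\<lambda>r. M r (\<gamma> c)"] bij_betwE[OF \<gamma>] that
    unfolding near_magic_def M'_def by auto
  moreover have "(\<Sum>c<q. M' r c) \<in> {R, R + 1}" if "r < p" for r
    using assms(1) sum.reindex_bij_betw[OF \<gamma>, of "\<lambda>c. M (\<rho> r) c"] bij_betwE[OF \<rho>] that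
    unfolding near_magic_def M'_def by auto
  ultimately have "near_magic p q M' C R"
    unfolding near_magic_def by blast
  moreover have "M' 0 0 = 0"
    using 0 by (simp add: M'_def \<rho>_def \<gamma>_def)
  ultimately show ?thesis by blast
qed

section \<open>From arrays to labelings\<close>

text \<open>Index 0 means the apex, so the other indices are shifted by one. The corner yields the
  singleton \<open>{(0, 0)}\<close>, which is no edge and is excluded below.\<close>

definition edge_at :: "nat \<times> nat \<Rightarrow> (nat \<times> nat) set" where
  "edge_at = (\<lambda>(r, c). {if r = 0 then (0, 0) else (1, r - 1), if c = 0 then (0, 0) else (2, c - 1)})"

lemma verts_complete_tripartite:
  "verts (complete_tripartite 1 m n) = insert (0, 0) ({1} \<times> {..<m} \<union> {2} \<times> {..<n})"
proof -
  have "{..<length [1, m, n]} = {0, 1, 2}" by auto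
  then have "verts (complete_tripartite 1 m n) = (SIGMA i:{0, 1, 2}. {..<[1, m, n] ! i})"
    by (simp only: complete_multipartite_def Let_def fst_conv)
  also have "\<dots> = {0} \<times> {..<1} \<union> ({1} \<times> {..<m} \<union> {2} \<times> {..<n})"
    by (auto simp: less_Suc_eq)
  finally show ?thesis by (simp add: lessThan_Suc)
qed

lemma edge_complete_tripartite:
  "{u, v} \<in> edges (complete_tripartite a b c) \<longleftrightarrow>
     u \<in> verts (complete_tripartite a b c) \<and> v \<in> verts (complete_tripartite a b c) \<and> fst u \<noteq> fst v"
  (is "?L \<longleftrightarrow> ?R")
proof
  assume ?L
  then obtain x y where "{u, v} = {x, y}" "fst x \<noteq> fst y"
    "x \<in> verts (complete_tripartite a b c)" "y \<in> verts (complete_tripartite a b c)"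
    unfolding complete_multipartite_def Let_def fst_conv snd_conv by blast
  then show ?R by (auto simp only: doubleton_eq_iff)
next
  assume ?R
  then show ?L
    unfolding complete_multipartite_def Let_def fst_conv snd_conv by blast
qed

lemma bij_betw_edge_at:
  "bij_betw edge_at ({..m} \<times> {..n} - {(0, 0)}) (edges (complete_tripartite 1 m n))"
  unfolding bij_betw_def
proof (intro conjI subset_antisym)
  show "inj_on edge_at ({..m} \<times> {..n} - {(0, 0)})"
    by (rule inj_onI) (auto simp: edge_at_def doubleton_eq_iff split: if_splits)
  show "edge_at ` ({..m} \<times> {..n} - {(0, 0)}) \<subseteq> edges (complete_tripartite 1 m n)"
    by (auto simp: edge_at_def edge_complete_tripartite verts_complete_tripartite
      simp del: One_nat_def split: if_splits)
  show "edges (complete_tripartite 1 m n) \<subseteq> edge_at ` ({..m} \<times> {..n} - {(0, 0)})"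
  proof
    fix e assume e: "e \<in> edges (complete_tripartite 1 m n)"
    then obtain u v where uv: "e = {u, v}"
      by (auto simp: complete_multipartite_def Let_def)
    \<comment> \<open>\<open>idx k w\<close> is the index that \<open>w\<close> contributes to part
      \<open>k\<close>, with 0 outside that part. No edge has both endpoints in one part, so adding
      over the endpoints recovers the cell in either order of \<open>u\<close> and
      \<open>v\<close>.\<close>
    define idx where "idx k w = (if fst w = k then Suc (snd w) else 0)" for k and w :: "nat \<times> nat"
    from e uv have "e = edge_at (idx 1 u + idx 1 v, idx 2 u + idx 2 v)"
      "(idx 1 u + idx 1 v, idx 2 u + idx 2 v) \<in> {..m} \<times> {..n} - {(0, 0)}"
      by (auto simp: edge_complete_tripartite verts_complete_tripartite edge_at_def idx_def simp del: One_nat_def)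
    then show "e \<in> edge_at ` ({..m} \<times> {..n} - {(0, 0)})" by blast
  qed
qed

text \<open>Removing the corner removes exactly the value 0, leaving the labels from 1 up to the
  number of edges. Being 0, the corner can be put back into the sums, so that weights become full
  row and column sums.\<close>

lemma array_labeling:
  assumes bij: "bij_betw (\<lambda>(r, c). M r c) ({..m} \<times> {..n}) {..<(m + 1) * (n + 1)}"
    and M0: "M 0 0 = (0::nat)"
  obtains f where
    "bij_betw f (edges (complete_tripartite 1 m n)) {1..card (edges (complete_tripartite 1 m n))}"
    "weight (complete_tripartite 1 m n) f (0, 0) = (\<Sum>r\<le>m. M r 0) + (\<Sum>c\<le>n. M 0 c)"
    "\<And>i. i < m \<Longrightarrow> weight (complete_tripartite 1 m n) f (1, i) = (\<Sum>c\<le>n. M (Suc i) c)"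
    "\<And>j. j < n \<Longrightarrow> weight (complete_tripartite 1 m n) f (2, j) = (\<Sum>r\<le>m. M r (Suc j))"
proof -
  let ?G = "complete_tripartite 1 m n" and ?A = "{..m} \<times> {..n} - {(0, 0)}"
  define f where "f e = (\<lambda>(r, c). M r c) (the_inv_into ?A edge_at e)" for e
  note edge_bij = bij_betw_edge_at[of m n]
  have inj: "inj_on edge_at ?A" and img: "edge_at ` ?A = edges ?G"
    using edge_bij by (auto simp: bij_betw_def)
  have card: "card (edges ?G) = (m + 1) * (n + 1) - 1"
    using bij_betw_same_card[OF edge_bij] by (simp add: card_Diff_singleton)
  have f_edge: "f (edge_at x) = (case x of (r, c) \<Rightarrow> M r c)" if "x \<in> ?A" for x
    using the_inv_into_f_f[OF inj that] by (simp add: f_def)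
  have "bij_betw (\<lambda>(r, c). M r c) ?A ({..<(m + 1) * (n + 1)} - {0})"
    using bij_betw_DiffI[OF bij, of "{(0, 0)}" "{0}"] M0 by (auto simp: bij_betw_def)
  then have "bij_betw f (edges ?G) ({..<(m + 1) * (n + 1)} - {0})"
    unfolding f_def using bij_betw_trans[OF bij_betw_the_inv_into[OF edge_bij]]
    by (auto simp: comp_def)
  also have "{..<(m + 1) * (n + 1)} - {0} = {1..card (edges ?G)}"
    unfolding card by auto
  finally have f_bij: "bij_betw f (edges ?G) {1..card (edges ?G)}" .
  have weight: "weight ?G f u = (\<Sum>(r, c)\<in>{x \<in> ?A. u \<in> edge_at x}. M r c)" for u
  proof -
    have "incident_edges ?G u = edge_at ` {x \<in> ?A. u \<in> edge_at x}"
      unfolding incident_edges_def img[symmetric] by blast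
    moreover have "inj_on edge_at {x \<in> ?A. u \<in> edge_at x}"
      using inj by (rule inj_on_subset) auto
    ultimately have "weight ?G f u = (\<Sum>x\<in>{x \<in> ?A. u \<in> edge_at x}. f (edge_at x))"
      unfolding weight_def by (simp add: sum.reindex)
    also have "\<dots> = (\<Sum>(r, c)\<in>{x \<in> ?A. u \<in> edge_at x}. M r c)"
      by (rule sum.cong) (auto simp: f_edge)
    finally show ?thesis .
  qed
  have w0: "weight ?G f (0, 0) = (\<Sum>r\<le>m. M r 0) + (\<Sum>c\<le>n. M 0 c)"
  proof -
    have "{x \<in> ?A. (0, 0) \<in> edge_at x} = (\<lambda>r. (r, 0)) ` {1..m} \<union> Pair 0 ` {1..n}"
      by (auto simp: edge_at_def image_iff split: if_splits)
    then have "weight ?G f (0, 0) =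
        (\<Sum>(r, c)\<in>(\<lambda>r. (r, 0)) ` {1..m} \<union> Pair 0 ` {1..n}. M r c)"
      by (simp only: weight)
    also have "\<dots> = (\<Sum>(r, c)\<in>(\<lambda>r. (r, 0)) ` {1..m}. M r c) + (\<Sum>(r, c)\<in>Pair 0 ` {1..n}. M r c)"
      by (rule sum.union_disjoint) auto
    also have "\<dots> = (\<Sum>r\<in>{1..m}. M r 0) + (\<Sum>c\<in>{1..n}. M 0 c)"
      by (simp add: sum.reindex inj_on_def)
    finally show ?thesis
      using M0 by (simp add: sum.atMost_shift sum.atLeast1_atMost_eq)
  qed
  have w1: "weight ?G f (1, i) = (\<Sum>c\<le>n. M (Suc i) c)" if "i < m" for i
  proof -
    have "{x \<in> ?A. (1, i) \<in> edge_at x} = Pair (Suc i) ` {..n}"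
      using that by (auto simp: edge_at_def split: if_splits)
    then show ?thesis unfolding weight by (simp add: sum.reindex inj_on_def)
  qed
  have w2: "weight ?G f (2, j) = (\<Sum>r\<le>m. M r (Suc j))" if "j < n" for j
  proof -
    have "{x \<in> ?A. (2, j) \<in> edge_at x} = (\<lambda>r. (r, Suc j)) ` {..m}"
      using that by (auto simp: edge_at_def split: if_splits)
    then show ?thesis unfolding weight by (simp add: sum.reindex inj_on_def)
  qed
  show thesis by (rule that[OF f_bij w0 w1 w2])
qed

text \<open>The two large parts get colors in \<open>A\<close> and \<open>B\<close>, and the apex a
  sum from both, so disjointness and \<open>sep\<close> make the coloring proper. Having sets on
  both sides lets the bound serve an array and its transpose alike.\<close>

lemma local_antimagic_chromatic_number_le_array:
  assumes bij: "bij_betw (\<lambda>(r, c). M r c) ({..m} \<times> {..n}) {..<(m + 1) * (n + 1)}"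
    and M0: "M 0 0 = (0::nat)"
    and rows: "\<And>r. r \<le> m \<Longrightarrow> (\<Sum>c\<le>n. M r c) \<in> A"
    and cols: "\<And>c. c \<le> n \<Longrightarrow> (\<Sum>r\<le>m. M r c) \<in> B"
    and "A \<inter> B = {}" "finite A" "finite B"
    and sep: "\<And>a b. a \<in> A \<Longrightarrow> b \<in> B \<Longrightarrow> a + b \<notin> A \<union> B"
  shows "\<chi>\<^sub>l\<^sub>a (complete_tripartite 1 m n) \<le> enat (card A + card B + 1)"
proof -
  let ?G = "complete_tripartite 1 m n"
  obtain f where f: "bij_betw f (edges ?G) {1..card (edges ?G)}"
    and w0: "weight ?G f (0, 0) = (\<Sum>r\<le>m. M r 0) + (\<Sum>c\<le>n. M 0 c)"
    and w1: "\<And>i. i < m \<Longrightarrow> weight ?G f (1, i) = (\<Sum>c\<le>n. M (Suc i) c)"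
    and w2: "\<And>j. j < n \<Longrightarrow> weight ?G f (2, j) = (\<Sum>r\<le>m. M r (Suc j))"
    using array_labeling[OF bij M0] by blast
  have in_A: "weight ?G f (1, i) \<in> A" if "i < m" for i
    using w1[OF that] rows[of "Suc i"] that by simp
  have in_B: "weight ?G f (2, j) \<in> B" if "j < n" for j
    using w2[OF that] cols[of "Suc j"] that by simp
  have apex: "weight ?G f (0, 0) \<notin> A \<union> B"
    using sep[OF rows[of 0] cols[of 0]] unfolding w0 by (simp add: add.commute)
  have "weight ?G f u \<noteq> weight ?G f v" if "{u, v} \<in> edges ?G" for u v
    using that in_A in_B apex \<open>A \<inter> B = {}\<close>
    unfolding edge_complete_tripartite verts_complete_tripartite by fastforce
  with f have "local_antimagic_labeling ?G f"
    unfolding local_antimagic_labeling_def by blast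
  then have "\<chi>\<^sub>l\<^sub>a ?G \<le> enat (card (weight ?G f ` verts ?G))"
    unfolding local_antimagic_chromatic_number_def by (intro INF_lower) simp
  also have "weight ?G f ` verts ?G \<subseteq> insert (weight ?G f (0, 0)) (A \<union> B)"
    using in_A in_B unfolding verts_complete_tripartite by auto
  then have "card (weight ?G f ` verts ?G) \<le> card (insert (weight ?G f (0, 0)) (A \<union> B))"
    using \<open>finite A\<close> \<open>finite B\<close> by (intro card_mono) auto
  also have "\<dots> \<le> card A + card B + 1"
    using \<open>finite A\<close> \<open>finite B\<close> card_Un_le[of A B] by (simp add: card_insert_if)
  finally show ?thesis by simp
qed

section \<open>Lower bound\<close>

lemma local_antimagic_chromatic_number_ge_3:
  assumes "m > 0" "n > 0"
  shows "3 \<le> \<chi>\<^sub>l\<^sub>a (complete_tripartite 1 m n)"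
  unfolding local_antimagic_chromatic_number_def
proof (rule INF_greatest)
  let ?G = "complete_tripartite 1 m n"
  fix f assume "f \<in> {f. local_antimagic_labeling ?G f}"
  then have "weight ?G f u \<noteq> weight ?G f v" if "{u, v} \<in> edges ?G" for u v
    using that unfolding local_antimagic_labeling_def by blast
  then have "card {weight ?G f (0, 0), weight ?G f (1, 0), weight ?G f (2, 0)} = 3"
    using assms by (simp add: edge_complete_tripartite verts_complete_tripartite del: One_nat_def)
  moreover have "card {weight ?G f (0, 0), weight ?G f (1, 0), weight ?G f (2, 0)}
      \<le> card (weight ?G f ` verts ?G)"
    using assms unfolding verts_complete_tripartite by (intro card_mono) auto
  ultimately have "3 \<le> card (weight ?G f ` verts ?G)" by simp
  then show "3 \<le> enat (card (weight ?G f ` verts ?G))"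
    by (simp add: numeral_eq_enat)
qed

section \<open>Upper bound\<close>

text \<open>With T = (m + 1) * (n + 1) - 1, both 2 * C and 2 * R + 1 are multiples of T. If C were R
  or R + 1, they would differ by 1, contradicting T > 1. The bounds C > 1 and R > 0 push the apex
  weight, at least R + C, above all other colors.\<close>

lemma near_magic_separated:
  assumes "odd m" "m \<ge> 2" "even n" "n \<ge> 2"
  obtains M C R where "near_magic (m + 1) (n + 1) M C R" "M 0 0 = 0" "C > 1" "R > 0"
    "C \<noteq> R" "C \<noteq> R + 1"
proof -
  define h q where "h = (m + 1) div 2" and "q = n + 1"
  have h: "m + 1 = 2 * h" "h > 1" and q: "odd q" "q \<ge> 3"
    using assms unfolding h_def q_def by auto
  define T where "T = 2 * h * q - 1"
  have "2 * 2 * 3 \<le> 2 * h * q"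
    using h q by (intro mult_mono) auto
  then have T: "T > 1" unfolding T_def by simp
  obtain M C R where M: "near_magic (2 * h) q M C R" "C = h * T" and R: "2 * R + 1 = q * T"
    using near_magic_exists[of h q] h q unfolding T_def by auto
  then obtain M' where M': "near_magic (2 * h) q M' C R" "M' 0 0 = 0"
    using near_magic_corner[OF M(1)] h q by auto
  have "C > 1"
    using h T unfolding M(2) by (simp add: one_less_mult)
  have "q * T \<ge> 3 * 1" using q T by (intro mult_mono) auto
  then have "R > 0" using R by simp
  have "T dvd 2 * C" "T dvd 2 * R + 1" unfolding M(2) R by simp_all
  note dvd = dvd_diff_nat[OF this] dvd_diff_nat[OF this(2,1)]
  have "C \<noteq> R" using dvd(2) T by auto
  moreover have "C \<noteq> R + 1" using dvd(1) T by auto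
  ultimately show thesis
    using that[of M' C R] M' \<open>C > 1\<close> \<open>R > 0\<close> unfolding h(1) q_def by blast
qed

theorem theorem2p7:
  fixes m n :: nat
  assumes "m \<ge> 2" and "n \<ge> 2" and "m mod 2 \<noteq> n mod 2"
  shows "3 \<le> \<chi>\<^sub>l\<^sub>a (complete_tripartite 1 m n) \<and> \<chi>\<^sub>l\<^sub>a (complete_tripartite 1 m n) \<le> 4"
proof
  show "3 \<le> \<chi>\<^sub>l\<^sub>a (complete_tripartite 1 m n)"
    using assms by (intro local_antimagic_chromatic_number_ge_3) auto
  consider "odd m" "even n" | "even m" "odd n"
    using assms(3) by (metis even_iff_mod_2_eq_zero odd_iff_mod_2_eq_one)
  then show "\<chi>\<^sub>l\<^sub>a (complete_tripartite 1 m n) \<le> 4"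
  proof cases
    case 1
    then obtain M C R where M: "near_magic (m + 1) (n + 1) M C R" "M 0 0 = 0"
      and CR: "C > 1" "R > 0" "C \<noteq> R" "C \<noteq> R + 1"
      using near_magic_separated[of m n] assms by blast
    have "\<chi>\<^sub>l\<^sub>a (complete_tripartite 1 m n) \<le> enat (card {R, R + 1} + card {C} + 1)"
      by (rule local_antimagic_chromatic_number_le_array[of M])
        (use M CR in \<open>auto simp: near_magic_def lessThan_Suc_atMost less_Suc_eq_le\<close>)
    then show ?thesis by (simp add: numeral_eq_enat eval_nat_numeral)
  next
    case 2
    then obtain M C R where M: "near_magic (n + 1) (m + 1) M C R" "M 0 0 = 0"
      and CR: "C > 1" "R > 0" "C \<noteq> R" "C \<noteq> R + 1"
      using near_magic_separated[of n m] assms by blast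
    \<comment> \<open>Here \<open>n + 1\<close>, the number of columns, is the even side, so the
      array is transposed: its rows now sum to \<open>C\<close> and its columns to \<open>R\<close>
      or \<open>R + 1\<close>.\<close>
    have "bij_betw ((\<lambda>(r, c). M r c) \<circ> prod.swap) ({..m} \<times> {..n}) {..<(m + 1) * (n + 1)}"
      using M(1) by (intro bij_betw_trans[of _ _ "{..n} \<times> {..m}"])
        (auto simp: near_magic_def lessThan_Suc_atMost mult.commute bij_betw_def)
    then have "bij_betw (\<lambda>(r, c). M c r) ({..m} \<times> {..n}) {..<(m + 1) * (n + 1)}"
      by (simp add: comp_def case_prod_unfold)
    then have "\<chi>\<^sub>l\<^sub>a (complete_tripartite 1 m n) \<le> enat (card {C} + card {R, R + 1} + 1)"
      by (rule local_antimagic_chromatic_number_le_array)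
        (use M CR in \<open>auto simp: near_magic_def lessThan_Suc_atMost less_Suc_eq_le\<close>)
    then show ?thesis by (simp add: numeral_eq_enat eval_nat_numeral)
  qed
qed

end
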